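(* Let $\gamma\in(0,1)$, let $\alpha>\beta$ and $\tau>0$ be constants, and let $G_n\sim\mathrm{PDSM}(n,\mu_1,\mu_2,\tau^2)$ with $\mu_1=\alpha\sqrt{\frac{\log n}{n}}$, $\mu_2=\beta\sqrt{\frac{\log n}{n}}$ and planted labeling $\zeta^*\in\Theta_n^\gamma$. Let $\mathrm{SNR}=\frac{(\alpha-\beta)^2}{8\tau^2}$. If $\gamma\,\mathrm{SNR}>1$, then the maximum likelihood estimator recovers $\zeta^*$: $$\mathbb{P}\left[M(\hat\zeta_{MLE},\zeta^* )=1\right]\to1\quad\text{as } n\to\infty .$$
   Context: $[n]=\{1,\dots,n\}$; $n$ ranges over positive integers for which $\gamma n$ is an integer; $\Theta_n^\gamma=\{\zeta\in\{0,1\}^n:\sum_i\zeta_i=\gamma n\}$. Gaussian weighted planted dense subgraph model $\mathrm{PDSM}(n,\mu_1,\mu_2,\tau^2)$ (with parameter $\gamma$): given a planted (unobserved) labeling $\zeta^*\in\Theta_n^\gamma$, the observed symmetric weighted adjacency matrix $A=(A_{ij})_{i,j\in[n]}$ has $A_{ii}=0$, and, independently over unordered pairs $\{i,j\}$ with $i\neq j$, $A_{ij}=A_{ji}\sim N(\mu_1,\tau^2)$ if $\zeta_i^*=\zeta_j^*=1$ and $A_{ij}=A_{ji}\sim N(\mu_2,\tau^2)$ otherwise. Agreement ratio: $M(\hat\zeta,\zeta)=\frac1n\sum_{i=1}^n\mathbf 1_{\hat\zeta_i=\zeta_i}$ for $\hat\zeta,\zeta\in\{0,1\}^n$. The maximum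 likelihood estimator is $\hat\zeta_{MLE}\in\arg\max_{\zeta\in\Theta_n^\gamma}g_A(\zeta)$ with $g_A(\zeta)=\sum_{i,j}A_{ij}\zeta_i\zeta_j$. *)

theory Defs
  imports "HOL-Probability.Probability"
begin

text \<open>Vectors indexed by $[n]$ are functions that are \<^const>\<open>undefined\<close> outside \<^term>\<open>{1..n}\<close>,
  so equality of labelings is equality of their \<^term>\<open>n\<close> entries.\<close>

definition labelings :: "real \<Rightarrow> nat \<Rightarrow> (nat \<Rightarrow> nat) set" where
  "labelings \<gamma> n = {\<zeta> \<in> {1..n} \<rightarrow>\<^sub>E {0, 1}. real (\<Sum>i\<in>{1..n}. \<zeta> i) = \<gamma> * real n}"

definition admissible_sizes :: "real \<Rightarrow> nat set" where
  "admissible_sizes \<gamma> = {n. n > 0 \<and> \<gamma> * real n \<in> \<int>}"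

text \<open>\<^term>\<open>A\<close> is a random matrix on the probability space \<^term>\<open>M\<close>; unordered pairs are
  represented by \<^term>\<open>i < j\<close>. As in \<^const>\<open>normal_density\<close>, the last parameter \<^term>\<open>\<tau>\<close>
  is the standard deviation.\<close>

definition is_PDSM ::
  "'a measure \<Rightarrow> ('a \<Rightarrow> nat \<Rightarrow> nat \<Rightarrow> real) \<Rightarrow> nat \<Rightarrow> (nat \<Rightarrow> nat) \<Rightarrow> real \<Rightarrow> real \<Rightarrow> real \<Rightarrow> bool" where
  "is_PDSM M A n \<zeta> \<mu>\<^sub>1 \<mu>\<^sub>2 \<tau> \<longleftrightarrow>
     prob_space M \<and>
     (\<forall>\<omega>\<in>space M. \<forall>i\<in>{1..n}. A \<omega> i i = 0) \<and>
     (\<forall>\<omega>\<in>space M. \<forall>i\<in>{1..n}. \<forall>j\<in>{1..n}. A \<omega> i j = A \<omega> j i) \<and>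
     prob_space.indep_vars M (\<lambda>_. borel) (\<lambda>(i, j) \<omega>. A \<omega> i j)
       {(i, j). i \<in> {1..n} \<and> j \<in> {1..n} \<and> i < j} \<and>
     (\<forall>i\<in>{1..n}. \<forall>j\<in>{1..n}. i < j \<longrightarrow>
        distributed M lborel (\<lambda>\<omega>. A \<omega> i j)
          (normal_density (if \<zeta> i = 1 \<and> \<zeta> j = 1 then \<mu>\<^sub>1 else \<mu>\<^sub>2) \<tau>))"

definition agreement :: "nat \<Rightarrow> (nat \<Rightarrow> nat) \<Rightarrow> (nat \<Rightarrow> nat) \<Rightarrow> real" where
  "agreement n \<xi> \<zeta> = (1 / real n) * (\<Sum>i\<in>{1..n}. if \<xi> i = \<zeta> i then 1 else 0)"

definition g_score :: "nat \<Rightarrow> (nat \<Rightarrow> nat \<Rightarrow> real) \<Rightarrow> (nat \<Rightarrow> nat) \<Rightarrow> real" where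
  "g_score n A \<zeta> = (\<Sum>i\<in>{1..n}. \<Sum>j\<in>{1..n}. A i j * real (\<zeta> i) * real (\<zeta> j))"

text \<open>The maximiser need not be unique: an MLE is any random labeling that always lies in the
  arg max, with an arbitrary measurable choice among ties.\<close>

definition is_MLE ::
  "'a measure \<Rightarrow> ('a \<Rightarrow> nat \<Rightarrow> nat \<Rightarrow> real) \<Rightarrow> real \<Rightarrow> nat \<Rightarrow> ('a \<Rightarrow> nat \<Rightarrow> nat) \<Rightarrow> bool" where
  "is_MLE M A \<gamma> n \<xi> \<longleftrightarrow>
     \<xi> \<in> M \<rightarrow>\<^sub>M count_space (labelings \<gamma> n) \<and>
     (\<forall>\<omega>\<in>space M. is_arg_max (g_score n (A \<omega>)) (\<lambda>\<zeta>. \<zeta> \<in> labelings \<gamma> n) (\<xi> \<omega>))"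

definition SNR :: "real \<Rightarrow> real \<Rightarrow> real \<Rightarrow> real" where
  "SNR \<alpha> \<beta> \<tau> = (\<alpha> - \<beta>)\<^sup>2 / (8 * \<tau>\<^sup>2)"

end

theory Submission
  imports Defs "HOL-Real_Asymp.Real_Asymp"
begin

text \<open>
  The estimator can only fail if some competitor $\zeta \neq \zeta^*$ of the same size scores at
  least as much as $\zeta^*$, so a union bound over competitors suffices. Write $K = \gamma n$ for
  the size of the planted set and let $\zeta$ be at Hamming distance $d = 2k$ from $\zeta^*$, so that
  it replaces $k$ planted vertices by $k$ others. Up to a factor $2$, its score minus that of
  $\zeta^*$ is a sum of $N$ edges outside the planted set minus $N$ edges inside it, where
  $N = k(2K - k - 1)/2$. This is Gaussian with mean $-(\mu_1 - \mu_2) N$ and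
  variance $2 \tau^2 N$, so the probability that it is nonnegative is at most
  \[ \exp\Big(-\frac{(\mu_1-\mu_2)^2}{4\tau^2} N\Big)
     = \exp\Big(-\mathrm{SNR}\,\frac{\log n}{n}\, k(2 \gamma n - k - 1)\Big). \]
  This step is \<open>score_exceeds_planted_prob_le\<close>.

  The sum of these bounds is controlled in two regimes. When $k$ is a small fraction of $n$ the bound
  is close to $n^{-2 \gamma k \mathrm{SNR}} = n^{-\gamma d\, \mathrm{SNR}}$, which beats the roughly
  $n^{2k} = n^d$ competitors at that distance exactly because $\gamma\,\mathrm{SNR} > 1$. When
  $k$ is of order $n$ the factor $2\gamma n - k - 1$ may drop to about $\gamma n$, but the bound is
  still $\exp(-c\, n \log n)$ and there are at most $2^n$ labelings altogether. Both regimes are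
  summarised in \<open>competitor_weight_le\<close>: every competitor has weight at most $q^d + R$ with
  $q = n^{-(1+\epsilon)}$ and $R = e^{-\delta n \log n}$.

  No binomial coefficients are needed to sum these weights. A competitor is determined by the set on
  which it disagrees with $\zeta^*$, so its $q^d$ is one of the terms of
  $\sum_{\emptyset \neq S \subseteq [n]} q^{|S|} = (1+q)^n - 1 \le e^{nq} - 1$, which tends
  to $0$ since $nq = n^{-\epsilon}$. The remaining part is $2^n R \to 0$. The resulting error bound
  for fixed $n$ is \<open>MLE_error_prob_le\<close>.
\<close>

section \<open>Tails of Gaussian linear combinations\<close>

text \<open>If $x \ge 0 \ge \mu$, then $(x-\mu)^2 \ge x^2 + \mu^2$. Hence on the half-line the density
  is at most $e^{-\mu^2/(2\sigma^2)}$ times the centred one, whose total mass is $1$.\<close>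

lemma (in prob_space) normal_nonneg_prob_le:
  assumes X: "distributed M lborel X (normal_density \<mu> \<sigma>)"
    and "\<mu> \<le> 0" "\<sigma> > 0"
  shows "prob {\<omega> \<in> space M. 0 \<le> X \<omega>} \<le> exp (- \<mu>\<^sup>2 / (2 * \<sigma>\<^sup>2))"
proof -
  have pointwise: "normal_density \<mu> \<sigma> x \<le> exp (- \<mu>\<^sup>2 / (2 * \<sigma>\<^sup>2)) * normal_density 0 \<sigma> x"
    if "x \<ge> 0" for x
  proof -
    have "\<mu>\<^sup>2 + x\<^sup>2 \<le> (x - \<mu>)\<^sup>2"
      using mult_nonneg_nonpos[OF that \<open>\<mu> \<le> 0\<close>] by (simp add: power2_diff mult.commute)
    then have "- (x - \<mu>)\<^sup>2 / (2 * \<sigma>\<^sup>2) \<le> - \<mu>\<^sup>2 / (2 * \<sigma>\<^sup>2) + - (x - 0)\<^sup>2 / (2 * \<sigma>\<^sup>2)"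
      by (subst add_divide_distrib[symmetric], intro divide_right_mono) auto
    then have "exp (- (x - \<mu>)\<^sup>2 / (2 * \<sigma>\<^sup>2))
        \<le> exp (- \<mu>\<^sup>2 / (2 * \<sigma>\<^sup>2)) * exp (- (x - 0)\<^sup>2 / (2 * \<sigma>\<^sup>2))"
      by (metis exp_add exp_le_cancel_iff)
    then show ?thesis
      unfolding normal_density_def
      by (subst mult.left_commute, intro mult_left_mono) auto
  qed
  have "{\<omega> \<in> space M. 0 \<le> X \<omega>} = X -` {0..} \<inter> space M"
    by auto
  then have "emeasure M {\<omega> \<in> space M. 0 \<le> X \<omega>}
      = (\<integral>\<^sup>+x. ennreal (normal_density \<mu> \<sigma> x) * indicator {0..} x \<partial>lborel)"
    using distributed_emeasure[OF X, of "{0..}"] by simp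
  also have "\<dots> \<le> (\<integral>\<^sup>+x. ennreal (exp (- \<mu>\<^sup>2 / (2 * \<sigma>\<^sup>2)) * normal_density 0 \<sigma> x) \<partial>lborel)"
    using pointwise by (intro nn_integral_mono) (auto simp: indicator_def intro!: ennreal_leI)
  also have "\<dots> = ennreal (exp (- \<mu>\<^sup>2 / (2 * \<sigma>\<^sup>2)))"
    using \<open>\<sigma> > 0\<close> by (subst nn_integral_eq_integral) (auto simp: normal_density_nonneg)
  finally show ?thesis
    by (simp add: emeasure_eq_measure)
qed

text \<open>Terms with zero coefficient are constants rather than normal variables, so the sum is first
  restricted to the support of the coefficients. If that support is empty, the right-hand side is $1$
  because division by zero yields zero.\<close>

lemma (in prob_space) indep_normal_combination_nonneg_prob_le:
  fixes X :: "'i \<Rightarrow> 'a \<Rightarrow> real" and c \<mu> \<sigma> :: "'i \<Rightarrow> real"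
  assumes "finite I" and indep: "indep_vars (\<lambda>_. borel) X I"
    and \<sigma>: "\<And>p. p \<in> I \<Longrightarrow> \<sigma> p > 0"
    and X: "\<And>p. p \<in> I \<Longrightarrow> distributed M lborel (X p) (normal_density (\<mu> p) (\<sigma> p))"
    and mean: "(\<Sum>p\<in>I. c p * \<mu> p) \<le> 0"
  shows "prob {\<omega> \<in> space M. 0 \<le> (\<Sum>p\<in>I. c p * X p \<omega>)}
           \<le> exp (- (\<Sum>p\<in>I. c p * \<mu> p)\<^sup>2 / (2 * (\<Sum>p\<in>I. (c p)\<^sup>2 * (\<sigma> p)\<^sup>2)))"
proof (cases "\<forall>p\<in>I. c p = 0")
  case True
  then show ?thesis by simp
next
  case False
  define J where "J = {p \<in> I. c p \<noteq> 0}"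
  have J: "finite J" "J \<subseteq> I" "J \<noteq> {}"
    using False \<open>finite I\<close> by (auto simp: J_def)
  have restrict: "(\<Sum>p\<in>J. c p * f p) = (\<Sum>p\<in>I. c p * f p)" for f
    using \<open>finite I\<close> by (intro sum.mono_neutral_left) (auto simp: J_def)
  have "(\<Sum>p\<in>J. (\<bar>c p\<bar> * \<sigma> p)\<^sup>2) = (\<Sum>p\<in>I. (c p)\<^sup>2 * (\<sigma> p)\<^sup>2)"
    using restrict[of "\<lambda>p. c p * (\<sigma> p)\<^sup>2"]
    by (simp add: power_mult_distrib mult.assoc[symmetric] flip: power2_eq_square)
  moreover have "distributed M lborel (\<lambda>\<omega>. \<Sum>p\<in>J. c p * X p \<omega>)
      (normal_density (\<Sum>p\<in>J. c p * \<mu> p) (sqrt (\<Sum>p\<in>J. (\<bar>c p\<bar> * \<sigma> p)\<^sup>2)))"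
  proof (rule sum_indep_normal)
    show "indep_vars (\<lambda>_. borel) (\<lambda>p \<omega>. c p * X p \<omega>) J"
      by (rule indep_vars_compose2[OF indep_vars_subset[OF indep \<open>J \<subseteq> I\<close>]]) simp
    show "distributed M lborel (\<lambda>\<omega>. c p * X p \<omega>) (normal_density (c p * \<mu> p) (\<bar>c p\<bar> * \<sigma> p))"
      if "p \<in> J" for p
      using normal_density_affine[of "X p" "\<mu> p" "\<sigma> p" "c p" 0] X[of p] \<sigma>[of p] that
      by (simp add: J_def)
  qed (use J \<sigma> in \<open>auto simp: J_def\<close>)
  moreover have "(\<Sum>p\<in>J. (\<bar>c p\<bar> * \<sigma> p)\<^sup>2) > 0"
    using J \<sigma> by (intro sum_pos) (auto simp: J_def dest!: \<sigma>)
  ultimately show ?thesis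
    using mean normal_nonneg_prob_le[of "\<lambda>\<omega>. \<Sum>p\<in>I. c p * X p \<omega>" "\<Sum>p\<in>I. c p * \<mu> p"
        "sqrt (\<Sum>p\<in>I. (c p)\<^sup>2 * (\<sigma> p)\<^sup>2)"]
    by (simp add: restrict)
qed

section \<open>Edge counts of labelings\<close>

definition pairs :: "nat \<Rightarrow> (nat \<times> nat) set" where
  "pairs n = {(i, j). i \<in> {1..n} \<and> j \<in> {1..n} \<and> i < j}"

lemma finite_pairs [simp]: "finite (pairs n)"
  by (rule finite_subset[of _ "{1..n} \<times> {1..n}"]) (auto simp: pairs_def)

lemma sum_symmetric_eq_pairs:
  fixes B :: "nat \<Rightarrow> nat \<Rightarrow> real"
  assumes sym: "\<And>i j. i \<in> {1..n} \<Longrightarrow> j \<in> {1..n} \<Longrightarrow> B i j = B j i"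
  shows "(\<Sum>i\<in>{1..n}. \<Sum>j\<in>{1..n}. B i j)
           = 2 * (\<Sum>(i, j)\<in>pairs n. B i j) + (\<Sum>i\<in>{1..n}. B i i)"
proof -
  define L D where "L = prod.swap ` pairs n" and "D = (\<lambda>i. (i, i)) ` {1..n}"
  have "{1..n} \<times> {1..n} = pairs n \<union> L \<union> D"
    by (auto simp: pairs_def L_def D_def image_iff)
  moreover have "pairs n \<inter> L = {}" "(pairs n \<union> L) \<inter> D = {}"
    by (auto simp: pairs_def L_def D_def)
  moreover have "finite L" "finite D"
    by (auto simp: L_def D_def)
  ultimately have "(\<Sum>i\<in>{1..n}. \<Sum>j\<in>{1..n}. B i j)
      = (\<Sum>(i, j)\<in>pairs n. B i j) + (\<Sum>(i, j)\<in>L. B i j) + (\<Sum>(i, j)\<in>D. B i j)"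
    by (simp add: sum.cartesian_product sum.union_disjoint)
  moreover have "(\<Sum>(i, j)\<in>L. B i j) = (\<Sum>(i, j)\<in>pairs n. B i j)"
    unfolding L_def by (subst sum.reindex) (auto intro!: sum.cong sym simp: pairs_def)
  moreover have "(\<Sum>(i, j)\<in>D. B i j) = (\<Sum>i\<in>{1..n}. B i i)"
    unfolding D_def by (subst sum.reindex) (auto intro: inj_onI)
  ultimately show ?thesis by simp
qed

lemma sum_pairs_01:
  fixes f :: "nat \<Rightarrow> real"
  assumes "\<And>i. i \<in> {1..n} \<Longrightarrow> f i \<in> {0, 1}"
  shows "(\<Sum>(i, j)\<in>pairs n. f i * f j) = ((sum f {1..n})\<^sup>2 - sum f {1..n}) / 2"
proof -
  have "(\<Sum>i\<in>{1..n}. f i * f i) = sum f {1..n}"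
    using assms by (intro sum.cong) force+
  moreover have "(\<Sum>i\<in>{1..n}. \<Sum>j\<in>{1..n}. f i * f j) = (sum f {1..n})\<^sup>2"
    by (simp add: power2_eq_square sum_product)
  ultimately show ?thesis
    using sum_symmetric_eq_pairs[of n "\<lambda>i j. f i * f j"] by (simp add: mult.commute)
qed

definition disagreement :: "nat \<Rightarrow> (nat \<Rightarrow> nat) \<Rightarrow> (nat \<Rightarrow> nat) \<Rightarrow> nat set" where
  "disagreement n \<zeta> \<zeta>' = {i \<in> {1..n}. \<zeta> i \<noteq> \<zeta>' i}"

lemma labelings_01:
  "\<zeta> \<in> labelings \<gamma> n \<Longrightarrow> i \<in> {1..n} \<Longrightarrow> \<zeta> i = 0 \<or> \<zeta> i = 1"
  by (auto simp: labelings_def PiE_iff)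

lemma sum_labeling: "\<zeta> \<in> labelings \<gamma> n \<Longrightarrow> (\<Sum>i\<in>{1..n}. real (\<zeta> i)) = \<gamma> * real n"
  by (simp add: labelings_def)

text \<open>Both labelings have $\gamma n$ ones, and each common one removes two disagreements from
  the $2 \gamma n$ that disjoint supports would give.\<close>

lemma labelings_overlap:
  assumes "\<zeta> \<in> labelings \<gamma> n" "\<zeta>' \<in> labelings \<gamma> n"
  shows "(\<Sum>i\<in>{1..n}. real (\<zeta> i) * real (\<zeta>' i))
           = \<gamma> * real n - real (card (disagreement n \<zeta> \<zeta>')) / 2"
proof -
  have "real (card (disagreement n \<zeta> \<zeta>')) = (\<Sum>i\<in>{1..n}. if \<zeta> i \<noteq> \<zeta>' i then 1 else 0)"
    by (subst sum.inter_filter[symmetric]) (auto simp: disagreement_def)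
  also have "\<dots> = (\<Sum>i\<in>{1..n}. real (\<zeta> i) + real (\<zeta>' i) - 2 * (real (\<zeta> i) * real (\<zeta>' i)))"
    using labelings_01[OF assms(1)] labelings_01[OF assms(2)]
    by (intro sum.cong) force+
  also have "\<dots> = 2 * \<gamma> * real n - 2 * (\<Sum>i\<in>{1..n}. real (\<zeta> i) * real (\<zeta>' i))"
    using sum_labeling[OF assms(1)] sum_labeling[OF assms(2)]
    by (simp add: sum.distrib sum_subtractf sum_distrib_left)
  finally show ?thesis by (simp add: field_simps)
qed

section \<open>A competitor beating the planted labeling\<close>

text \<open>The score difference is the combination of the independent edge weights with coefficients
  $c_{ij} = \zeta_i\zeta_j - \zeta^*_i\zeta^*_j \in \{-1, 0, 1\}$. Its mean and its variance
  are fixed by the edge counts of $\zeta$, of $\zeta^*$ and of their overlap, which depend only on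
  the common size $K$ and the overlap size $m = K - d/2$. The number of edges with a nonzero
  coefficient is $W = (K^2 - K) - (m^2 - m)$, half of them with each sign. The Gaussian tail bound
  thus has mean $-(\mu_1 - \mu_2) W / 2$ and variance $\tau^2 W$.\<close>

lemma score_exceeds_planted_prob_le:
  assumes pdsm: "is_PDSM M A n \<zeta>' \<mu>\<^sub>1 \<mu>\<^sub>2 \<tau>" and "\<tau> > 0" "\<mu>\<^sub>2 \<le> \<mu>\<^sub>1"
    and \<zeta>: "\<zeta> \<in> labelings \<gamma> n" and \<zeta>': "\<zeta>' \<in> labelings \<gamma> n"
    and d: "d = real (card (disagreement n \<zeta> \<zeta>'))"
  shows "measure M {\<omega> \<in> space M. g_score n (A \<omega>) \<zeta>' \<le> g_score n (A \<omega>) \<zeta>}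
           \<le> exp (- ((\<mu>\<^sub>1 - \<mu>\<^sub>2)\<^sup>2 / (8 * \<tau>\<^sup>2)) * (d / 2 * (2 * \<gamma> * real n - d / 2 - 1)))"
proof -
  interpret prob_space M
    using pdsm by (simp add: is_PDSM_def)
  define z z' where "z = (\<lambda>i. real (\<zeta> i))" and "z' = (\<lambda>i. real (\<zeta>' i))"
  define K m where "K = \<gamma> * real n" and "m = K - d / 2"
  define c where "c = (\<lambda>(i, j). z i * z j - z' i * z' j)"
  define \<mu> where "\<mu> = (\<lambda>(i, j). \<mu>\<^sub>2 + (\<mu>\<^sub>1 - \<mu>\<^sub>2) * (z' i * z' j))"
  define W where "W = d / 2 * (2 * K - d / 2 - 1)"
  have z01: "z i = 0 \<or> z i = 1" "z' i = 0 \<or> z' i = 1" if "i \<in> {1..n}" for i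
    using labelings_01[OF \<zeta> that] labelings_01[OF \<zeta>' that] by (auto simp: z_def z'_def)
  have pair01: "z i = 0 \<or> z i = 1" "z' i = 0 \<or> z' i = 1" "z j = 0 \<or> z j = 1" "z' j = 0 \<or> z' j = 1"
    if "(i, j) \<in> pairs n" for i j
    using that z01 by (auto simp: pairs_def)

  have zz: "(\<Sum>(i, j)\<in>pairs n. z i * z j) = (K\<^sup>2 - K) / 2"
    using sum_pairs_01[of n z] z01 sum_labeling[OF \<zeta>] by (auto simp: z_def K_def)
  have z'z': "(\<Sum>(i, j)\<in>pairs n. z' i * z' j) = (K\<^sup>2 - K) / 2"
    using sum_pairs_01[of n z'] z01 sum_labeling[OF \<zeta>'] by (auto simp: z'_def K_def)
  have "(\<Sum>(i, j)\<in>pairs n. (z i * z' i) * (z j * z' j)) = (m\<^sup>2 - m) / 2"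
  proof (subst sum_pairs_01)
    show "z i * z' i \<in> {0, 1}" if "i \<in> {1..n}" for i
      using z01[OF that] by auto
  qed (use labelings_overlap[OF \<zeta> \<zeta>'] in \<open>simp add: z_def z'_def m_def K_def d\<close>)
  then have overlap: "(\<Sum>(i, j)\<in>pairs n. (z i * z j) * (z' i * z' j)) = (m\<^sup>2 - m) / 2"
    by (simp add: mult_ac)
  have W: "W = K\<^sup>2 - K - (m\<^sup>2 - m)"
    by (simp add: W_def m_def power2_eq_square field_simps)

  have "(\<Sum>p\<in>pairs n. (c p)\<^sup>2)
      = (\<Sum>(i, j)\<in>pairs n. z i * z j + z' i * z' j - 2 * ((z i * z j) * (z' i * z' j)))"
    using pair01 by (intro sum.cong) (force simp: c_def)+
  also have "\<dots> = W"
    using zz z'z' overlap W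
    by (simp add: case_prod_unfold sum.distrib sum_subtractf sum_distrib_left[symmetric])
  finally have sum_c2: "(\<Sum>p\<in>pairs n. (c p)\<^sup>2) = W" .
  then have "W \<ge> 0"
    by (metis sum_nonneg zero_le_power2)

  have "(\<Sum>p\<in>pairs n. c p * \<mu> p)
      = (\<Sum>(i, j)\<in>pairs n. \<mu>\<^sub>2 * (z i * z j) - \<mu>\<^sub>2 * (z' i * z' j)
           + (\<mu>\<^sub>1 - \<mu>\<^sub>2) * ((z i * z j) * (z' i * z' j)) - (\<mu>\<^sub>1 - \<mu>\<^sub>2) * (z' i * z' j))"
    using pair01 by (intro sum.cong) (force simp: c_def \<mu>_def algebra_simps)+
  also have "\<dots> = \<mu>\<^sub>2 * (\<Sum>(i, j)\<in>pairs n. z i * z j) - \<mu>\<^sub>2 * (\<Sum>(i, j)\<in>pairs n. z' i * z' j)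
      + (\<mu>\<^sub>1 - \<mu>\<^sub>2) * (\<Sum>(i, j)\<in>pairs n. (z i * z j) * (z' i * z' j))
      - (\<mu>\<^sub>1 - \<mu>\<^sub>2) * (\<Sum>(i, j)\<in>pairs n. z' i * z' j)"
    by (simp add: case_prod_unfold sum.distrib sum_subtractf flip: sum_distrib_left)
  also have "\<dots> = - ((\<mu>\<^sub>1 - \<mu>\<^sub>2) * W / 2)"
    unfolding zz z'z' overlap W by (simp add: field_simps)
  finally have mean: "(\<Sum>p\<in>pairs n. c p * \<mu> p) = - ((\<mu>\<^sub>1 - \<mu>\<^sub>2) * W / 2)" .

  have score: "g_score n (A \<omega>) \<eta> = 2 * (\<Sum>(i, j)\<in>pairs n. A \<omega> i j * real (\<eta> i) * real (\<eta> j))"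
    if "\<omega> \<in> space M" for \<omega> \<eta>
    using pdsm that unfolding g_score_def is_PDSM_def
    by (subst sum_symmetric_eq_pairs) (auto simp: mult_ac)
  have "(g_score n (A \<omega>) \<zeta>' \<le> g_score n (A \<omega>) \<zeta>)
      \<longleftrightarrow> 0 \<le> (\<Sum>p\<in>pairs n. c p * (case p of (i, j) \<Rightarrow> A \<omega> i j))" if "\<omega> \<in> space M" for \<omega>
  proof -
    have "(\<Sum>p\<in>pairs n. c p * (case p of (i, j) \<Rightarrow> A \<omega> i j))
        = (\<Sum>(i, j)\<in>pairs n. A \<omega> i j * real (\<zeta> i) * real (\<zeta> j))
          - (\<Sum>(i, j)\<in>pairs n. A \<omega> i j * real (\<zeta>' i) * real (\<zeta>' j))"
      unfolding sum_subtractf[symmetric]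
      by (intro sum.cong) (auto simp: c_def z_def z'_def algebra_simps)
    then show ?thesis
      by (simp add: score[OF that])
  qed
  then have event: "{\<omega> \<in> space M. g_score n (A \<omega>) \<zeta>' \<le> g_score n (A \<omega>) \<zeta>}
      = {\<omega> \<in> space M. 0 \<le> (\<Sum>p\<in>pairs n. c p * (case p of (i, j) \<Rightarrow> A \<omega> i j))}"
    by auto

  have "prob {\<omega> \<in> space M. 0 \<le> (\<Sum>p\<in>pairs n. c p * (case p of (i, j) \<Rightarrow> A \<omega> i j))}
      \<le> exp (- (\<Sum>p\<in>pairs n. c p * \<mu> p)\<^sup>2 / (2 * (\<Sum>p\<in>pairs n. (c p)\<^sup>2 * \<tau>\<^sup>2)))"
  proof (rule indep_normal_combination_nonneg_prob_le)
    show "indep_vars (\<lambda>_. borel) (\<lambda>p \<omega>. case p of (i, j) \<Rightarrow> A \<omega> i j) (pairs n)"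
      using pdsm by (simp add: is_PDSM_def pairs_def case_prod_unfold)
    show "distributed M lborel (\<lambda>\<omega>. case p of (i, j) \<Rightarrow> A \<omega> i j) (normal_density (\<mu> p) \<tau>)"
      if "p \<in> pairs n" for p
    proof -
      obtain i j where p: "p = (i, j)" by force
      have ij: "i \<in> {1..n}" "j \<in> {1..n}" "i < j"
        using that by (auto simp: p pairs_def)
      have "\<mu> p = (if \<zeta>' i = 1 \<and> \<zeta>' j = 1 then \<mu>\<^sub>1 else \<mu>\<^sub>2)"
        using labelings_01[OF \<zeta>' ij(1)] labelings_01[OF \<zeta>' ij(2)]
        by (auto simp: p \<mu>_def z'_def)
      then show ?thesis
        using pdsm ij by (simp add: is_PDSM_def p)
    qed
    show "(\<Sum>p\<in>pairs n. c p * \<mu> p) \<le> 0"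
      using \<open>W \<ge> 0\<close> \<open>\<mu>\<^sub>2 \<le> \<mu>\<^sub>1\<close> by (simp add: mean)
  qed (use \<open>\<tau> > 0\<close> in auto)
  also have "- (\<Sum>p\<in>pairs n. c p * \<mu> p)\<^sup>2 / (2 * (\<Sum>p\<in>pairs n. (c p)\<^sup>2 * \<tau>\<^sup>2))
      = - ((\<mu>\<^sub>1 - \<mu>\<^sub>2)\<^sup>2 / (8 * \<tau>\<^sup>2)) * W"
    unfolding mean sum_distrib_right[symmetric] sum_c2
    \<comment> \<open>If $W = 0$, the left-hand side is a division by zero, and both sides vanish.\<close>
    using \<open>\<tau> > 0\<close> by (cases "W = 0") (simp_all add: power2_eq_square field_simps)
  finally show ?thesis
    by (simp only: event W_def K_def mult.assoc)
qed

section \<open>The union bound\<close>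

lemma finite_labelings [simp]: "finite (labelings \<gamma> n)"
  by (rule finite_subset[of _ "{1..n} \<rightarrow>\<^sub>E {0, 1}"]) (auto simp: labelings_def intro: finite_PiE)

lemma inj_on_disagreement:
  assumes \<zeta>': "\<zeta>' \<in> labelings \<gamma> n"
  shows "inj_on (\<lambda>\<zeta>. disagreement n \<zeta> \<zeta>') (labelings \<gamma> n)"
proof (rule inj_onI)
  fix \<zeta> \<eta> assume *: "\<zeta> \<in> labelings \<gamma> n" "\<eta> \<in> labelings \<gamma> n"
    and eq: "disagreement n \<zeta> \<zeta>' = disagreement n \<eta> \<zeta>'"
  show "\<zeta> = \<eta>"
  proof
    fix i
    show "\<zeta> i = \<eta> i"
    proof (cases "i \<in> {1..n}")
      case True
      with eq have "\<zeta> i = \<zeta>' i \<longleftrightarrow> \<eta> i = \<zeta>' i"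
        by (auto simp: disagreement_def)
      with labelings_01[OF *(1) True] labelings_01[OF *(2) True] labelings_01[OF \<zeta>' True] show ?thesis
        by auto
    next
      case False
      then show ?thesis
        using * by (auto simp: labelings_def PiE_iff extensional_def)
    qed
  qed
qed

lemma sum_power_card_Pow:
  fixes q :: real
  assumes "finite S"
  shows "(\<Sum>D\<in>Pow S. q ^ card D) = (1 + q) ^ card S"
  using prod_add[OF assms, of "\<lambda>_. q" "\<lambda>_. 1"] by (simp add: add.commute)

lemma agreement_eq_1_iff:
  assumes "n > 0" "\<zeta> \<in> labelings \<gamma> n" "\<zeta>' \<in> labelings \<gamma> n"
  shows "agreement n \<zeta> \<zeta>' = 1 \<longleftrightarrow> \<zeta> = \<zeta>'"
proof
  assume "agreement n \<zeta> \<zeta>' = 1"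
  then have "(\<Sum>i\<in>{1..n}. if \<zeta> i = \<zeta>' i then 1 else 0) = real n"
    using \<open>n > 0\<close> by (simp add: agreement_def)
  then have "(\<Sum>i\<in>{1..n}. if \<zeta> i = \<zeta>' i then 0 else 1 :: real) = 0"
    using sum_subtractf[of "\<lambda>_. 1 :: real" "\<lambda>i. if \<zeta> i = \<zeta>' i then 1 else 0" "{1..n}"]
    by (simp add: if_distrib[of "\<lambda>x. 1 - x"] cong: if_cong)
  then have "disagreement n \<zeta> \<zeta>' = disagreement n \<zeta>' \<zeta>'"
    by (subst (asm) sum_nonneg_eq_0_iff) (auto simp: disagreement_def split: if_splits)
  then show "\<zeta> = \<zeta>'"
    using inj_on_disagreement assms by (blast dest: inj_onD)
qed (use \<open>n > 0\<close> in \<open>simp add: agreement_def\<close>)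

text \<open>The hypothesis on the weights is only required for $d \le 2 \gamma n$, a bound on the
  distance between any two labelings with $\gamma n$ ones. Beyond it the quadratic exponent need not be
  favourable. The term $q^d$ is summed over all nonempty disagreement sets, the term $R$ over all
  subsets of $[n]$.\<close>

lemma MLE_error_prob_le:
  fixes q R :: real
  assumes pdsm: "is_PDSM M A n \<zeta>' \<mu>\<^sub>1 \<mu>\<^sub>2 \<tau>" and mle: "is_MLE M A \<gamma> n \<xi>"
    and "\<tau> > 0" "\<mu>\<^sub>2 \<le> \<mu>\<^sub>1" and \<zeta>': "\<zeta>' \<in> labelings \<gamma> n" and "q \<ge> 0" "R \<ge> 0"
    and weight: "\<And>d::nat. d \<le> 2 * \<gamma> * real n \<Longrightarrow>
      exp (- ((\<mu>\<^sub>1 - \<mu>\<^sub>2)\<^sup>2 / (8 * \<tau>\<^sup>2)) * (real d / 2 * (2 * \<gamma> * real n - real d / 2 - 1)))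
        \<le> q ^ d + R"
  shows "measure M {\<omega> \<in> space M. \<xi> \<omega> \<noteq> \<zeta>'} \<le> ((1 + q) ^ n - 1) + 2 ^ n * R"
proof -
  interpret prob_space M
    using pdsm by (simp add: is_PDSM_def)
  define \<Theta> where "\<Theta> = labelings \<gamma> n - {\<zeta>'}"
  define E where "E = (\<lambda>\<zeta>. {\<omega> \<in> space M. g_score n (A \<omega>) \<zeta>' \<le> g_score n (A \<omega>) \<zeta>})"
  define D where "D = (\<lambda>\<zeta>. disagreement n \<zeta> \<zeta>')"
  have \<xi>: "\<xi> \<in> M \<rightarrow>\<^sub>M count_space (labelings \<gamma> n)"
    and argmax: "\<And>\<omega>. \<omega> \<in> space M \<Longrightarrow> is_arg_max (g_score n (A \<omega>)) (\<lambda>\<zeta>. \<zeta> \<in> labelings \<gamma> n) (\<xi> \<omega>)"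
    using mle by (auto simp: is_MLE_def)
  have A_less: "(\<lambda>\<omega>. A \<omega> i j) \<in> borel_measurable M" if "i \<in> {1..n}" "j \<in> {1..n}" "i < j" for i j
  proof -
    have "distributed M lborel (\<lambda>\<omega>. A \<omega> i j)
        (normal_density (if \<zeta>' i = 1 \<and> \<zeta>' j = 1 then \<mu>\<^sub>1 else \<mu>\<^sub>2) \<tau>)"
      using pdsm that by (simp add: is_PDSM_def)
    then show ?thesis
      by (auto dest: distributed_measurable)
  qed
  have A: "(\<lambda>\<omega>. A \<omega> i j) \<in> borel_measurable M" if ij: "i \<in> {1..n}" "j \<in> {1..n}" for i j
  proof (cases i j rule: linorder_cases)
    case less
    with ij show ?thesis by (rule A_less)
  next
    case equal
    then have "(\<lambda>\<omega>. A \<omega> i j) \<in> borel_measurable M \<longleftrightarrow> (\<lambda>\<omega>. 0 :: real) \<in> borel_measurable M"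
      using pdsm ij by (intro measurable_cong) (simp add: is_PDSM_def)
    then show ?thesis by simp
  next
    case greater
    have "(\<lambda>\<omega>. A \<omega> i j) \<in> borel_measurable M \<longleftrightarrow> (\<lambda>\<omega>. A \<omega> j i) \<in> borel_measurable M"
      using pdsm ij by (intro measurable_cong) (simp add: is_PDSM_def)
    with ij greater show ?thesis using A_less by blast
  qed
  have "(\<lambda>\<omega>. g_score n (A \<omega>) \<zeta>) \<in> borel_measurable M" for \<zeta>
    unfolding g_score_def by (intro borel_measurable_sum borel_measurable_times A) auto
  then have E: "E \<zeta> \<in> events" for \<zeta>
    unfolding E_def by measurable
  have "finite \<Theta>"
    by (simp add: \<Theta>_def)
  have D_inj: "inj_on D \<Theta>"
    unfolding D_def \<Theta>_def by (rule inj_on_subset[OF inj_on_disagreement[OF \<zeta>']]) auto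
  have D_sub: "D ` \<Theta> \<subseteq> Pow {1..n} - {{}}"
  proof safe
    fix \<zeta> assume "\<zeta> \<in> \<Theta>" "D \<zeta> = {}"
    then have "disagreement n \<zeta> \<zeta>' = disagreement n \<zeta>' \<zeta>'"
      by (simp add: D_def disagreement_def)
    then show False
      using inj_onD[OF inj_on_disagreement[OF \<zeta>'], of \<zeta> \<zeta>'] \<zeta>' \<open>\<zeta> \<in> \<Theta>\<close>
      by (auto simp: \<Theta>_def)
  qed (auto simp: D_def disagreement_def)

  have "{\<omega> \<in> space M. \<xi> \<omega> \<noteq> \<zeta>'} \<subseteq> (\<Union>\<zeta>\<in>\<Theta>. E \<zeta>)"
    using argmax \<zeta>' measurable_space[OF \<xi>]
    by (fastforce simp: \<Theta>_def E_def is_arg_max_linorder)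
  then have "prob {\<omega> \<in> space M. \<xi> \<omega> \<noteq> \<zeta>'} \<le> prob (\<Union>\<zeta>\<in>\<Theta>. E \<zeta>)"
    using E \<open>finite \<Theta>\<close> by (intro finite_measure_mono) auto
  also have "\<dots> \<le> (\<Sum>\<zeta>\<in>\<Theta>. prob (E \<zeta>))"
    using E \<open>finite \<Theta>\<close> by (intro finite_measure_subadditive_finite) auto
  also have "\<dots> \<le> (\<Sum>\<zeta>\<in>\<Theta>. q ^ card (D \<zeta>) + R)"
  proof (rule sum_mono)
    fix \<zeta> assume "\<zeta> \<in> \<Theta>"
    then have \<zeta>: "\<zeta> \<in> labelings \<gamma> n" by (simp add: \<Theta>_def)
    have "0 \<le> (\<Sum>i\<in>{1..n}. real (\<zeta> i) * real (\<zeta>' i))"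
      by (intro sum_nonneg) auto
    then have "card (D \<zeta>) \<le> 2 * \<gamma> * real n"
      unfolding labelings_overlap[OF \<zeta> \<zeta>'] D_def by simp
    from weight[OF this] show "prob (E \<zeta>) \<le> q ^ card (D \<zeta>) + R"
      using score_exceeds_planted_prob_le[OF pdsm \<open>\<tau> > 0\<close> \<open>\<mu>\<^sub>2 \<le> \<mu>\<^sub>1\<close> \<zeta> \<zeta>' refl]
      unfolding E_def D_def by linarith
  qed
  also have "\<dots> = (\<Sum>S\<in>D ` \<Theta>. q ^ card S + R)"
    by (simp add: sum.reindex[OF D_inj])
  also have "\<dots> \<le> (\<Sum>S\<in>Pow {1..n} - {{}}. q ^ card S + R)"
    using D_sub \<open>q \<ge> 0\<close> \<open>R \<ge> 0\<close> by (intro sum_mono2) auto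
  also have "\<dots> = ((1 + q) ^ n - 1) + real (card (Pow {1..n} - {{}})) * R"
    using sum_power_card_Pow[of "{1..n}" q] by (simp add: sum.distrib sum_diff1)
  also have "card (Pow {1..n} - {{}}) \<le> 2 ^ n"
    by (metis card_Diff1_le card_Pow card_atLeastAtMost diff_Suc_1 finite_atLeastAtMost)
  then have "real (card (Pow {1..n} - {{}})) * R \<le> 2 ^ n * R"
    using \<open>R \<ge> 0\<close> by (intro mult_right_mono) (metis of_nat_le_iff of_nat_numeral of_nat_power)
  finally show ?thesis by simp
qed

section \<open>Both regimes of the weights\<close>

text \<open>Here $s$ is the signal-to-noise ratio. The margin $\gamma s - 1 > 0$ is split evenly:
  $\delta$ is chosen so that $s(\gamma - \delta) = 1 + \epsilon$ is halfway between $1$ and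
  $\gamma s$. If $d/2 \le \delta n$, then $2\gamma n - d/2 - 1 \ge 2(\gamma-\delta) n$, which gives
  the first term. Otherwise $d/2 \le \gamma n$ gives $2\gamma n - d/2 - 1 \ge (\gamma - \delta) n$,
  and together with $d/2 > \delta n$ this gives the second. The condition $1 \le \delta n$ absorbs the
  $-1$ in both cases.\<close>

lemma competitor_weight_le:
  fixes s \<gamma> d :: real
  assumes "s > 0" "\<gamma> * s > 1" "n \<ge> 1" "0 \<le> d" "d \<le> 2 * \<gamma> * real n"
    and \<delta>: "\<delta> = (\<gamma> - 1 / s) / 2" and \<epsilon>: "\<epsilon> = (\<gamma> * s - 1) / 2" and large: "1 \<le> \<delta> * real n"
  shows "exp (- (s * ln (real n) / real n) * (d / 2 * (2 * \<gamma> * real n - d / 2 - 1)))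
           \<le> real n powr (- (1 + \<epsilon>) * d) + exp (- \<delta> * real n * ln (real n))"
proof -
  have "real n > 0" "ln (real n) \<ge> 0"
    using \<open>n \<ge> 1\<close> by auto
  have rate: "s * (\<gamma> - \<delta>) = 1 + \<epsilon>"
    using \<open>s > 0\<close> by (simp add: \<delta> \<epsilon> field_simps)
  have pos: "\<epsilon> > 0" "\<delta> > 0"
    using assms by (auto simp: \<delta> \<epsilon> field_simps)
  define T where "T = 2 * \<gamma> * real n - d / 2 - 1"
  have exponent: "s * ln (real n) / real n * (d / 2 * T) \<ge> (s * ln (real n) / real n) * (e / 2 * B)"
    if "0 \<le> e" "e \<le> d" "0 \<le> B" "B \<le> T" for e B
    using that \<open>s > 0\<close> \<open>ln (real n) \<ge> 0\<close> by (intro mult_left_mono mult_mono) auto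
  have \<gamma>\<delta>: "\<gamma> - \<delta> > 0"
    using rate pos \<open>s > 0\<close> by (smt (verit) mult_nonneg_nonpos)
  show ?thesis
  proof (cases "d \<le> 2 * \<delta> * real n")
    case True
    have "(s * ln (real n) / real n) * (d / 2 * (2 * (\<gamma> - \<delta>) * real n)) = s * (\<gamma> - \<delta>) * d * ln (real n)"
      using \<open>real n > 0\<close> by simp
    moreover have "2 * (\<gamma> - \<delta>) * real n \<le> T"
      using True large by (simp add: T_def algebra_simps)
    ultimately have "(1 + \<epsilon>) * d * ln (real n) \<le> s * ln (real n) / real n * (d / 2 * T)"
      using exponent[of d "2 * (\<gamma> - \<delta>) * real n"] \<gamma>\<delta> \<open>0 \<le> d\<close> by (simp add: rate)
    then have "exp (- (s * ln (real n) / real n) * (d / 2 * T)) \<le> real n powr (- (1 + \<epsilon>) * d)"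
      using \<open>real n > 0\<close> by (simp add: powr_def algebra_simps)
    then show ?thesis
      unfolding T_def by (smt (verit) exp_gt_zero)
  next
    case False
    have "(s * ln (real n) / real n) * (2 * \<delta> * real n / 2 * ((\<gamma> - \<delta>) * real n))
        = s * (\<gamma> - \<delta>) * (\<delta> * real n * ln (real n))"
      using \<open>real n > 0\<close> by simp
    moreover have "(\<gamma> - \<delta>) * real n \<le> T"
      using large assms(5) by (simp add: T_def algebra_simps)
    ultimately have "(1 + \<epsilon>) * (\<delta> * real n * ln (real n)) \<le> s * ln (real n) / real n * (d / 2 * T)"
      using exponent[of "2 * \<delta> * real n" "(\<gamma> - \<delta>) * real n"] \<gamma>\<delta> pos False by (simp add: rate)
    moreover have "1 * (\<delta> * real n * ln (real n)) \<le> (1 + \<epsilon>) * (\<delta> * real n * ln (real n))"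
      using pos \<open>ln (real n) \<ge> 0\<close> by (intro mult_right_mono) auto
    ultimately have "exp (- (s * ln (real n) / real n) * (d / 2 * T)) \<le> exp (- \<delta> * real n * ln (real n))"
      by simp
    then show ?thesis
      unfolding T_def by (smt (verit) powr_ge_zero)
  qed
qed

section \<open>Exact recovery\<close>

theorem theorem24:
  fixes \<gamma> \<alpha> \<beta> \<tau> :: real
    and M :: "nat \<Rightarrow> 'a measure"
    and A :: "nat \<Rightarrow> 'a \<Rightarrow> nat \<Rightarrow> nat \<Rightarrow> real"
    and \<zeta>star :: "nat \<Rightarrow> nat \<Rightarrow> nat"
    and \<zeta>MLE :: "nat \<Rightarrow> 'a \<Rightarrow> nat \<Rightarrow> nat"
  assumes "0 < \<gamma>" "\<gamma> < 1" and "\<alpha> > \<beta>" and "\<tau> > 0"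
    and "\<And>n. n \<in> admissible_sizes \<gamma> \<Longrightarrow> \<zeta>star n \<in> labelings \<gamma> n"
    and "\<And>n. n \<in> admissible_sizes \<gamma> \<Longrightarrow>
           is_PDSM (M n) (A n) n (\<zeta>star n)
             (\<alpha> * sqrt (ln (real n) / real n)) (\<beta> * sqrt (ln (real n) / real n)) \<tau>"
    and "\<And>n. n \<in> admissible_sizes \<gamma> \<Longrightarrow> is_MLE (M n) (A n) \<gamma> n (\<zeta>MLE n)"
    and "\<gamma> * SNR \<alpha> \<beta> \<tau> > 1"
  shows "((\<lambda>n. measure (M n) {\<omega> \<in> space (M n). agreement n (\<zeta>MLE n \<omega>) (\<zeta>star n) = 1}) \<longlongrightarrow> 1)
           (inf sequentially (principal (admissible_sizes \<gamma>)))"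
proof -
  define s where "s = SNR \<alpha> \<beta> \<tau>"
  define \<delta> \<epsilon> where "\<delta> = (\<gamma> - 1 / s) / 2" and "\<epsilon> = (\<gamma> * s - 1) / 2"
  have "s > 0" "\<gamma> * s > 1"
    using assms by (auto simp: s_def SNR_def)
  then have pos: "\<epsilon> > 0" "\<delta> > 0"
    by (auto simp: \<delta>_def \<epsilon>_def field_simps)
  define q R where "q = (\<lambda>n::nat. real n powr - (1 + \<epsilon>))"
    and "R = (\<lambda>n::nat. exp (- \<delta> * real n * ln (real n)))"
  define err where "err = (\<lambda>n. ((1 + q n) ^ n - 1) + 2 ^ n * R n)"

  have success: "1 - err n
      \<le> measure (M n) {\<omega> \<in> space (M n). agreement n (\<zeta>MLE n \<omega>) (\<zeta>star n) = 1}
    \<and> measure (M n) {\<omega> \<in> space (M n). agreement n (\<zeta>MLE n \<omega>) (\<zeta>star n) = 1} \<le> 1"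
    if n: "n \<in> admissible_sizes \<gamma>" and large: "1 \<le> \<delta> * real n" for n
  proof -
    have "n \<ge> 1" using n by (simp add: admissible_sizes_def)
    note pdsm = assms(6)[OF n] and mle = assms(7)[OF n] and star = assms(5)[OF n]
    interpret prob_space "M n"
      using pdsm by (simp add: is_PDSM_def)
    have \<xi>: "\<zeta>MLE n \<in> M n \<rightarrow>\<^sub>M count_space (labelings \<gamma> n)"
      using mle by (simp add: is_MLE_def)
    have "ln (real n) / real n \<ge> 0"
      using \<open>n \<ge> 1\<close> by simp
    then have rate: "(\<alpha> * sqrt (ln (real n) / real n) - \<beta> * sqrt (ln (real n) / real n))\<^sup>2 / (8 * \<tau>\<^sup>2)
        = s * ln (real n) / real n"
      by (simp add: left_diff_distrib[symmetric] power_mult_distrib s_def SNR_def)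
    have "prob {\<omega> \<in> space (M n). \<zeta>MLE n \<omega> \<noteq> \<zeta>star n} \<le> err n"
      unfolding err_def
    proof (rule MLE_error_prob_le[OF pdsm mle \<open>\<tau> > 0\<close> _ star])
      show "\<beta> * sqrt (ln (real n) / real n) \<le> \<alpha> * sqrt (ln (real n) / real n)"
        using \<open>\<alpha> > \<beta>\<close> \<open>ln (real n) / real n \<ge> 0\<close> by (intro mult_right_mono) auto
      show "exp (- ((\<alpha> * sqrt (ln (real n) / real n) - \<beta> * sqrt (ln (real n) / real n))\<^sup>2 / (8 * \<tau>\<^sup>2))
              * (real d / 2 * (2 * \<gamma> * real n - real d / 2 - 1))) \<le> q n ^ d + R n"
        if "real d \<le> 2 * \<gamma> * real n" for d
        using competitor_weight_le[OF \<open>s > 0\<close> \<open>\<gamma> * s > 1\<close> \<open>n \<ge> 1\<close> _ that \<delta>_def \<epsilon>_def large] \<open>n \<ge> 1\<close>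
        unfolding rate q_def R_def
        by (simp add: powr_powr[symmetric] powr_realpow del: powr_powr)
    qed (auto simp: q_def R_def)
    moreover have "{\<omega> \<in> space (M n). agreement n (\<zeta>MLE n \<omega>) (\<zeta>star n) = 1}
        = space (M n) - {\<omega> \<in> space (M n). \<zeta>MLE n \<omega> \<noteq> \<zeta>star n}"
      using agreement_eq_1_iff[of n _ \<gamma> "\<zeta>star n"] measurable_space[OF \<xi>] star \<open>n \<ge> 1\<close> by fastforce
    moreover have "{\<omega> \<in> space (M n). \<zeta>MLE n \<omega> \<noteq> \<zeta>star n} \<in> events"
    proof -
      have "{\<omega> \<in> space (M n). \<zeta>MLE n \<omega> \<noteq> \<zeta>star n}
          = \<zeta>MLE n -` (labelings \<gamma> n - {\<zeta>star n}) \<inter> space (M n)"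
        using measurable_space[OF \<xi>] by auto
      then show ?thesis
        using measurable_sets[OF \<xi>, of "labelings \<gamma> n - {\<zeta>star n}"] by simp
    qed
    ultimately show ?thesis
      by (auto simp: prob_compl)
  qed

  have "err \<longlonglongrightarrow> 0"
  proof -
    have "(\<lambda>n::nat. (1 + real n powr - (1 + \<epsilon>)) powr real n - 1
        + 2 powr real n * exp (- \<delta> * real n * ln (real n))) \<longlonglongrightarrow> 0"
      using pos by real_asymp
    then show ?thesis
      by (simp add: err_def q_def R_def powr_realpow add_pos_nonneg cong: if_cong)
  qed
  then have lower: "((\<lambda>n. 1 - err n) \<longlongrightarrow> 1) (inf sequentially (principal (admissible_sizes \<gamma>)))"
    using tendsto_diff[OF tendsto_const[of 1] \<open>err \<longlonglongrightarrow> 0\<close>]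
    by (intro tendsto_mono[OF inf_le1]) simp
  have "eventually (\<lambda>n. 1 \<le> \<delta> * real n) sequentially"
    using pos by real_asymp
  then have "eventually (\<lambda>n. n \<in> admissible_sizes \<gamma> \<and> 1 \<le> \<delta> * real n)
      (inf sequentially (principal (admissible_sizes \<gamma>)))"
    by (auto simp: eventually_inf_principal elim: eventually_mono)
  then show ?thesis
    by (intro tendsto_sandwich[OF _ _ lower tendsto_const])
       (auto elim!: eventually_mono dest: success)
qed

end
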